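(* For every finite nonempty subset $D \subset \mathbb{N}$ there is a numerical monoid $H$ such that $D \subset \Delta(H)$.
   Context: $\mathbb{N}$ denotes the positive integers and $\mathbb{N}_0 = \mathbb{N} \cup \{0\}$. A numerical monoid is a submonoid of $(\mathbb{N}_0,+)$ whose complement in $\mathbb{N}_0$ is finite. An atom of $H$ is a nonzero element that is not a sum of two nonzero elements of $H$. For $a \in H$, the set of lengths $\mathsf L(a)$ is the set of all $k \in \mathbb{N}_0$ such that $a$ is a sum of $k$ (not necessarily distinct) atoms of $H$ (so $\mathsf L(0) = \{0\}$). For a finite set $A = \{m_1, \ldots, m_k\} \subset \mathbb{Z}$ with $m_1 < \cdots < m_k$, its set of distances is $\Delta(A) = \{ m_i - m_{i-1} : 2 \le i \le k \}$. (All sets of lengths in a numerical monoid are finite.) The set of distances of $H$ is $\Delta(H) = \bigcup_{a \in H} \Delta(\mathsf L(a))$. *)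

theory Defs
  imports "HOL-Library.Multiset"
begin

definition numerical_monoid :: "nat set \<Rightarrow> bool" where
  "numerical_monoid H \<longleftrightarrow>
     0 \<in> H \<and> (\<forall>a\<in>H. \<forall>b\<in>H. a + b \<in> H) \<and> finite (- H)"

definition atoms :: "nat set \<Rightarrow> nat set" where
  "atoms H = {a \<in> H. a \<noteq> 0 \<and> \<not> (\<exists>b\<in>H. \<exists>c\<in>H. b \<noteq> 0 \<and> c \<noteq> 0 \<and> a = b + c)}"

definition lengths :: "nat set \<Rightarrow> nat \<Rightarrow> nat set" where
  "lengths H a = {k. \<exists>M. set_mset M \<subseteq> atoms H \<and> size M = k \<and> \<Sum>\<^sub># M = a}"

(* The list sorted_list_of_set A enumerates the finite set A as m_1 < ... < m_k, with indices
   shifted to start at 0; it is empty if A is infinite. On nat the truncated subtraction is the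
   true difference, because the list is increasing. *)
definition distances :: "'a::{linorder,minus} set \<Rightarrow> 'a set" where
  "distances A =
     {sorted_list_of_set A ! i - sorted_list_of_set A ! (i - 1) | i. 1 \<le> i \<and> i < card A}"

definition monoid_distances :: "nat set \<Rightarrow> nat set" where
  "monoid_distances H = (\<Union>a\<in>H. distances (lengths H a))"

end

theory Submission
  imports Defs "HOL-Number_Theory.Cong"
begin

text \<open>
  A single distance \<open>d\<close> is realized by the monoid generated by the coprime numbers \<open>n = d + 1\<close> and
  \<open>m = 2 * d + 1\<close>: the element \<open>n * m\<close> can be written only as \<open>m\<close> copies of \<open>n\<close> or as \<open>n\<close> copies
  of \<open>m\<close>, so its set of lengths is \<open>{n, m}\<close> and \<open>m - n = d\<close>.

  Distances realized in two different monoids \<open>A\<close> and \<open>B\<close> can be combined in one by gluing, that is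
  by passing to \<open>p * A + q * B\<close> with \<open>p\<close> and \<open>q\<close> coprime.  The point is that for \<open>x < q\<close> the part
  \<open>q * B\<close> is invisible below \<open>p * x\<close>: if \<open>p * x = p * a + q * b\<close>, then \<open>p\<close> divides \<open>b\<close> by
  coprimality, so \<open>b \<noteq> 0\<close> would give \<open>p * x \<ge> p * q\<close>.  Hence the factorizations of \<open>p * x\<close> are
  exactly the factorizations of \<open>x\<close> in \<open>A\<close>, scaled by \<open>p\<close>, and the sets of lengths agree
  (\<open>lengths_glue\<close>).  By symmetry the same holds for \<open>q * y\<close> with \<open>y < p\<close>.  Finitely many witnesses
  are bounded, so both \<open>p\<close> and \<open>q\<close> can be chosen large enough, and induction on the set of distances
  finishes the proof.
\<close>

section \<open>Gluing numerical monoids\<close>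

definition glue :: "nat \<Rightarrow> nat \<Rightarrow> nat set \<Rightarrow> nat set \<Rightarrow> nat set" where
  "glue p q A B = {p * a + q * b | a b. a \<in> A \<and> b \<in> B}"

lemma glue_commute: "glue p q A B = glue q p B A"
  unfolding glue_def by (auto simp: add.commute)

text \<open>Since \<open>p\<close> is invertible modulo \<open>q\<close>, some \<open>p * x\<close> with \<open>x < q\<close> is congruent to \<open>k\<close>; the bound
  on \<open>k\<close> guarantees \<open>p * x \<le> k\<close>, so the remaining multiple of \<open>q\<close> is not negative.\<close>

lemma large_nat_eq_coprime_combination:
  fixes p q k :: nat
  assumes "coprime p q" "q > 0" "k \<ge> p * q"
  obtains x y where "k = p * x + q * y"
proof -
  obtain z where z: "[p * z = 1] (mod q)"
    using cong_solve_coprime_nat[OF assms(1)] by auto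
  define x where "x = (z * k) mod q"
  have "[p * x = p * (z * k)] (mod q)"
    unfolding x_def by (intro cong_mult) simp_all
  also have "p * (z * k) = (p * z) * k"
    by simp
  also have "[(p * z) * k = 1 * k] (mod q)"
    using z by (intro cong_mult) simp_all
  finally have *: "[k = p * x] (mod q)"
    by (simp add: cong_sym)
  have "p * x \<le> p * q"
    using assms(2) unfolding x_def by (intro mult_le_mono2) (simp add: less_imp_le)
  then have "p * x \<le> k"
    using assms(3) by linarith
  with * have "q dvd k - p * x"
    by (simp add: cong_altdef_nat)
  then obtain y where "k - p * x = q * y" ..
  with \<open>p * x \<le> k\<close> show ?thesis
    using that[of x y] by linarith
qed

lemma cofinite_nat_iff: "finite (- H) \<longleftrightarrow> (\<exists>N::nat. {N..} \<subseteq> H)"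
proof
  assume "finite (- H)"
  then obtain N where "\<forall>x\<in>- H. x < N"
    using finite_nat_set_iff_bounded by blast
  then have "{N..} \<subseteq> H"
    by (meson ComplI atLeast_iff leD subsetI)
  then show "\<exists>N. {N..} \<subseteq> H" ..
next
  assume "\<exists>N. {N..} \<subseteq> H"
  then obtain N where "{N..} \<subseteq> H" ..
  then have "- H \<subseteq> {..<N}"
    by (meson ComplD atLeast_iff lessThan_iff not_le_imp_less subset_iff)
  then show "finite (- H)" by (rule finite_subset) simp
qed

lemma numerical_monoid_glue:
  assumes A: "numerical_monoid A" and B: "numerical_monoid B"
    and pq: "coprime p q" "q > 0"
  shows "numerical_monoid (glue p q A B)"
  unfolding numerical_monoid_def
proof (intro conjI ballI)
  have "0 = p * 0 + q * (0::nat)" by simp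
  then show "0 \<in> glue p q A B"
    using A B unfolding glue_def numerical_monoid_def by blast
next
  fix u v assume "u \<in> glue p q A B" "v \<in> glue p q A B"
  then obtain a b a' b' where
    "a \<in> A" "b \<in> B" "u = p * a + q * b" "a' \<in> A" "b' \<in> B" "v = p * a' + q * b'"
    unfolding glue_def by blast
  then have "a + a' \<in> A" "b + b' \<in> B" "u + v = p * (a + a') + q * (b + b')"
    using A B by (auto simp: numerical_monoid_def algebra_simps)
  then show "u + v \<in> glue p q A B"
    unfolding glue_def by blast
next
  obtain N M where N: "{N..} \<subseteq> A" and M: "{M..} \<subseteq> B"
    using A B by (auto simp: numerical_monoid_def cofinite_nat_iff)
  have "k \<in> glue p q A B" if "k \<ge> p * N + q * M + p * q" for k
  proof -
    have "k - (p * N + q * M) \<ge> p * q"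
      using that by linarith
    then obtain x y where "k - (p * N + q * M) = p * x + q * y"
      using large_nat_eq_coprime_combination[OF pq] by blast
    then have "k = p * (N + x) + q * (M + y)"
      using that by (simp add: algebra_simps)
    moreover have "N + x \<in> A" "M + y \<in> B"
      using N M by auto
    ultimately show ?thesis
      unfolding glue_def by blast
  qed
  then show "finite (- glue p q A B)"
    unfolding cofinite_nat_iff by (intro exI[of _ "p * N + q * M + p * q"]) auto
qed

lemma sum_mset_in_numerical_monoid:
  assumes "numerical_monoid H" "set_mset M \<subseteq> H"
  shows "\<Sum>\<^sub># M \<in> H"
  using assms(2)
proof (induction M)
  case empty
  then show ?case using assms(1) by (simp add: numerical_monoid_def)
next
  case (add x M)
  then show ?case using assms(1) by (simp add: numerical_monoid_def)
qed

section \<open>Factorizations in a glued monoid\<close>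

lemma second_coordinate_zero:
  fixes p q :: nat
  assumes "coprime p q" "p > 0" "x < q" "p * x = p * a + q * b"
  shows "b = 0"
proof -
  have "p dvd q * b"
    using assms(4) by (metis dvd_add_right_iff dvd_triv_left)
  then have "p dvd b"
    using assms(1) by (simp add: coprime_dvd_mult_right_iff)
  then obtain k where k: "b = p * k" ..
  then have "p * x = p * (a + q * k)"
    using assms(4) by (simp add: algebra_simps)
  then have "x = a + q * k"
    using assms(2) by simp
  with assms(3) have "k = 0"
    by (cases k) auto
  with k show ?thesis by simp
qed

text \<open>Below \<open>p * q\<close>, divisors in the glued monoid of an element of \<open>p * A\<close> stay in \<open>p * A\<close>.
  Splitting off one summand at a time, this transfers first membership, then being an atom, and
  finally whole factorizations from the glued monoid back to \<open>A\<close>.\<close>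

lemma glue_summands:
  assumes pq: "coprime p q" "p > 0" and "x < q"
    and "u \<in> glue p q A B" "v \<in> glue p q A B" "p * x = u + v"
  obtains a a' where "a \<in> A" "a' \<in> A" "u = p * a" "v = p * a'" "x = a + a'"
proof -
  obtain a b a' b' where *:
    "a \<in> A" "u = p * a + q * b" "a' \<in> A" "v = p * a' + q * b'"
    using assms unfolding glue_def by blast
  then have "p * x = p * (a + a') + q * (b + b')"
    using assms by (simp add: algebra_simps)
  then have b: "b + b' = 0"
    using second_coordinate_zero[OF pq \<open>x < q\<close>] by blast
  have "p * x = p * (a + a')"
    using assms(6) * b by (simp add: algebra_simps)
  then have "x = a + a'"
    using pq by simp
  with that[of a a'] * b show ?thesis by simp
qed

context
  fixes p q :: nat and A B :: "nat set"
  assumes A: "numerical_monoid A" and B: "numerical_monoid B"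
    and pq: "coprime p q" "p > 0"
begin

lemma mult_in_glue: "a \<in> A \<Longrightarrow> p * a \<in> glue p q A B"
  using B unfolding glue_def numerical_monoid_def by force

lemma mult_in_glue_iff:
  assumes "x < q"
  shows "p * x \<in> glue p q A B \<longleftrightarrow> x \<in> A"
proof
  assume "p * x \<in> glue p q A B"
  moreover have "0 \<in> glue p q A B"
    using mult_in_glue[of 0] A by (simp add: numerical_monoid_def)
  ultimately obtain a a' where "a \<in> A" "p * x = p * a"
    using glue_summands[OF pq assms, of "p * x" A B 0] by (metis add.right_neutral)
  then show "x \<in> A" using pq by simp
qed (rule mult_in_glue)

lemma mult_in_atoms_glue_iff:
  assumes "x < q"
  shows "p * x \<in> atoms (glue p q A B) \<longleftrightarrow> x \<in> atoms A"
proof -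
  have "(\<exists>b\<in>glue p q A B. \<exists>c\<in>glue p q A B. b \<noteq> 0 \<and> c \<noteq> 0 \<and> p * x = b + c) \<longleftrightarrow>
        (\<exists>b\<in>A. \<exists>c\<in>A. b \<noteq> 0 \<and> c \<noteq> 0 \<and> x = b + c)" (is "?L \<longleftrightarrow> ?R")
  proof
    assume ?L
    then obtain b c where bc: "b \<in> glue p q A B" "c \<in> glue p q A B"
        "b \<noteq> 0" "c \<noteq> 0" "p * x = b + c" by blast
    obtain a a' where "a \<in> A" "a' \<in> A" "b = p * a" "c = p * a'" "x = a + a'"
      using glue_summands[OF pq assms bc(1,2,5)] by blast
    with bc show ?R by (intro bexI[of _ a] bexI[of _ a']) auto
  next
    assume ?R
    then obtain b c where "b \<in> A" "c \<in> A" "b \<noteq> 0" "c \<noteq> 0" "x = b + c" by blast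
    then have "p * b \<in> glue p q A B" "p * c \<in> glue p q A B"
        "p * b \<noteq> 0" "p * c \<noteq> 0" "p * x = p * b + p * c"
      using pq by (simp_all add: mult_in_glue distrib_left)
    then show ?L by blast
  qed
  then show ?thesis
    using mult_in_glue_iff[OF assms] pq unfolding atoms_def mem_Collect_eq by simp
qed

text \<open>Scaling by \<open>p\<close> is a bijection between the factorizations of \<open>x\<close> in \<open>A\<close> and those of
  \<open>p * x\<close> in the glued monoid.\<close>

lemma lengths_glue:
  assumes x: "x < q"
  shows "lengths (glue p q A B) (p * x) = lengths A x"
proof (intro equalityI subsetI)
  fix k assume "k \<in> lengths A x"
  then obtain M where M: "set_mset M \<subseteq> atoms A" "size M = k" "\<Sum>\<^sub># M = x"
    unfolding lengths_def by blast
  have "p * a \<in> atoms (glue p q A B)" if "a \<in># M" for a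
  proof -
    have "a \<le> x" using that M(3) sum_mset.remove by fastforce
    then show ?thesis
      using that M(1) x by (auto simp: mult_in_atoms_glue_iff)
  qed
  then show "k \<in> lengths (glue p q A B) (p * x)"
    using M unfolding lengths_def
    by (intro CollectI exI[of _ "image_mset ((*) p) M"])
       (auto simp flip: sum_mset_distrib_left)
next
  fix k assume "k \<in> lengths (glue p q A B) (p * x)"
  then obtain M where M: "set_mset M \<subseteq> atoms (glue p q A B)" "size M = k" "\<Sum>\<^sub># M = p * x"
    unfolding lengths_def by blast
  have H: "numerical_monoid (glue p q A B)"
    using A B pq x by (intro numerical_monoid_glue) auto
  have M_sub: "set_mset M \<subseteq> glue p q A B"
    using M(1) by (auto simp: atoms_def)
  have *: "\<exists>a\<in>atoms A. u = p * a" if u: "u \<in># M" for u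
  proof -
    have "p * x = u + \<Sum>\<^sub># (M - {#u#})"
      using u M(3) by (metis sum_mset.remove)
    moreover have "u \<in> glue p q A B"
      using u M_sub by auto
    moreover have "\<Sum>\<^sub># (M - {#u#}) \<in> glue p q A B"
      using M_sub by (intro sum_mset_in_numerical_monoid[OF H]) (auto dest: in_diffD)
    ultimately obtain a a' where a: "u = p * a" "x = a + a'"
      using glue_summands[OF pq x] by metis
    then have "a \<in> atoms A"
      using u M(1) x by (subst mult_in_atoms_glue_iff[symmetric]) auto
    with a show ?thesis by blast
  qed
  define N where "N = image_mset (\<lambda>u. u div p) M"
  have "image_mset ((*) p) N = image_mset (\<lambda>u. u) M"
    unfolding N_def image_mset.compositionality comp_def
    using * by (intro image_mset_cong) fastforce
  then have "p * \<Sum>\<^sub># N = p * x"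
    using M(3) sum_mset_distrib_left[of p "\<lambda>a. a" N] by simp
  then have "\<Sum>\<^sub># N = x"
    using pq by simp
  moreover have "set_mset N \<subseteq> atoms A"
    using * pq by (fastforce simp: N_def)
  moreover have "size N = k"
    using M(2) by (simp add: N_def)
  ultimately show "k \<in> lengths A x"
    unfolding lengths_def by blast
qed

lemma distances_subset_glue:
  assumes "x \<in> A" "x < q"
  shows "distances (lengths A x) \<subseteq> monoid_distances (glue p q A B)"
  using mult_in_glue[OF assms(1)] lengths_glue[OF assms(2)]
  by (auto simp: monoid_distances_def intro!: bexI[of _ "p * x"])

end

section \<open>Realizing a single distance\<close>

lemma distances_doubleton:
  fixes m n :: nat
  assumes "n < m"
  shows "m - n \<in> distances {n, m}"
proof -
  have "sorted_list_of_set {n, m} = [n, m]"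
    using assms by simp
  then show ?thesis
    using assms unfolding distances_def
    by (intro CollectI exI[of _ 1]) simp
qed

lemma mset_doubleton:
  assumes "set_mset M \<subseteq> {n, m}"
  obtains i j where "M = replicate_mset i n + replicate_mset j m"
proof -
  from assms have "\<exists>i j. M = replicate_mset i n + replicate_mset j m"
  proof (induction M)
    case empty
    show ?case by (intro exI[of _ 0]) simp
  next
    case (add x M)
    then obtain i j where ij: "M = replicate_mset i n + replicate_mset j m" by auto
    have "x = n \<or> x = m" using add.prems by simp
    then show ?case
    proof
      assume "x = n"
      then show ?thesis using ij by (intro exI[of _ "Suc i"] exI[of _ j]) simp
    next
      assume "x = m"
      then show ?thesis using ij by (intro exI[of _ i] exI[of _ "Suc j"]) simp
    qed
  qed
  then show ?thesis using that by blast
qed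

text \<open>The condition \<open>m < 2 * n\<close> makes both generators atoms at once: a sum of two nonzero elements
  is at least \<open>2 * n\<close>.\<close>

lemma atoms_two_generated:
  fixes m n :: nat
  assumes "0 < n" "n < m" "m < 2 * n"
  shows "atoms (glue n m UNIV UNIV) = {n, m}"
proof -
  let ?H = "glue n m UNIV UNIV"
  have ge: "u \<ge> n" if "u \<in> ?H" "u \<noteq> 0" for u
  proof -
    from \<open>u \<in> ?H\<close> obtain a b where u: "u = n * a + m * b"
      unfolding glue_def by blast
    show ?thesis
    proof (cases a)
      case 0
      then have "m * 1 \<le> m * b" using u \<open>u \<noteq> 0\<close> by (intro mult_le_mono2) (cases b; simp)
      then show ?thesis using u assms by linarith
    next
      case (Suc c)
      then show ?thesis using u by simp
    qed
  qed
  have gen: "n * a + m * b \<in> ?H" for a b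
    unfolding glue_def by blast
  have mem: "n \<in> ?H" "m \<in> ?H"
    using gen[of 1 0] gen[of 0 1] by simp_all
  have atom: "u \<in> atoms ?H" if "u \<in> ?H" "0 < u" "u < 2 * n" for u
  proof -
    have "u \<noteq> v + w" if "v \<in> ?H" "w \<in> ?H" "v \<noteq> 0" "w \<noteq> 0" for v w
      using ge[of v] ge[of w] that \<open>u < 2 * n\<close> by linarith
    then show ?thesis
      using that unfolding atoms_def by blast
  qed
  show ?thesis
  proof (intro equalityI subsetI)
    fix u assume "u \<in> {n, m}"
    then show "u \<in> atoms ?H"
      using mem assms atom by auto
  next
    fix u assume u: "u \<in> atoms ?H"
    then obtain a b where ab: "u = n * a + m * b"
      unfolding atoms_def glue_def by blast
    have irred: "v = 0 \<or> w = 0" if "u = v + w" "v \<in> ?H" "w \<in> ?H" for v w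
      using u that unfolding atoms_def by blast
    show "u \<in> {n, m}"
    proof (cases a)
      case (Suc c)
      then have "u = n + (n * c + m * b)" using ab by simp
      then show ?thesis
        using irred[OF _ mem(1) gen] assms by fastforce
    next
      case 0
      have "u \<noteq> 0" using u by (simp add: atoms_def)
      then obtain c where "b = Suc c" using ab 0 by (cases b) auto
      then have "u = m + (n * 0 + m * c)" using ab 0 by simp
      then show ?thesis
        using irred[OF _ mem(2) gen] assms by fastforce
    qed
  qed
qed

text \<open>If \<open>i * n + j * m = n * m\<close>, then \<open>n\<close> divides \<open>j\<close> by coprimality, so \<open>j\<close> is \<open>0\<close> or \<open>n\<close>.\<close>

lemma lengths_two_generated:
  fixes m n :: nat
  assumes nm: "0 < n" "n < m" "m < 2 * n" "coprime n m"
  shows "lengths (glue n m UNIV UNIV) (n * m) = {n, m}"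
proof (intro equalityI subsetI)
  fix k assume "k \<in> lengths (glue n m UNIV UNIV) (n * m)"
  then obtain M where M: "set_mset M \<subseteq> {n, m}" "size M = k" "\<Sum>\<^sub># M = n * m"
    using atoms_two_generated[OF nm(1-3)] unfolding lengths_def by auto
  obtain i j where ij: "M = replicate_mset i n + replicate_mset j m"
    using mset_doubleton[OF M(1)] .
  have eq: "i * n + j * m = n * m" and k: "k = i + j"
    using M(2,3) ij by auto
  have "n dvd j * m"
    using eq by (metis dvd_add_right_iff dvd_triv_left dvd_triv_right)
  then have "n dvd j"
    using nm(4) by (simp add: coprime_dvd_mult_left_iff)
  then obtain c where c: "j = n * c" ..
  then have "n * (i + c * m) = n * m"
    using eq by (simp add: algebra_simps)
  then have i: "i + c * m = m"
    using nm(1) by simp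
  show "k \<in> {n, m}"
  proof (cases c)
    case 0
    then show ?thesis using i k c by simp
  next
    case (Suc c')
    then have "i = 0 \<and> c' * m = 0" using i by simp
    then show ?thesis using Suc k c nm by simp
  qed
next
  fix k assume "k \<in> {n, m}"
  then have "\<exists>M. set_mset M \<subseteq> {n, m} \<and> size M = k \<and> \<Sum>\<^sub># M = n * m"
  proof (elim insertE emptyE)
    assume "k = n"
    then show ?thesis
      by (intro exI[of _ "replicate_mset n m"]) auto
  next
    assume "k = m"
    then show ?thesis
      by (intro exI[of _ "replicate_mset m n"]) auto
  qed
  then show "k \<in> lengths (glue n m UNIV UNIV) (n * m)"
    using atoms_two_generated[OF nm(1-3)] unfolding lengths_def by simp
qed

lemma numerical_monoid_UNIV: "numerical_monoid UNIV"
  by (simp add: numerical_monoid_def)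

lemma numerical_monoid_with_distance:
  fixes d :: nat
  assumes "d > 0"
  obtains B y where "numerical_monoid B" "y \<in> B" "d \<in> distances (lengths B y)"
proof -
  \<comment> \<open>The least \<open>n\<close> such that \<open>m = n + d\<close> stays below \<open>2 * n\<close>; it is also coprime to \<open>d\<close>,
    hence to \<open>m\<close>.\<close>
  define n m where "n = d + 1" and "m = 2 * d + 1"
  have nm: "0 < n" "n < m" "m < 2 * n"
    using assms by (auto simp: n_def m_def)
  have "m = n + d"
    by (simp add: n_def m_def)
  then have "gcd n m = gcd n d" by simp
  moreover have "coprime n d"
    by (simp add: n_def)
  ultimately have cop: "coprime n m"
    by (simp add: coprime_iff_gcd_eq_1)
  have "numerical_monoid (glue n m UNIV UNIV)"
    using nm cop by (intro numerical_monoid_glue numerical_monoid_UNIV) auto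
  moreover have "n * m + m * 0 \<in> glue n m UNIV UNIV"
    unfolding glue_def by blast
  moreover have "d \<in> distances (lengths (glue n m UNIV UNIV) (n * m))"
    using distances_doubleton[OF nm(2)] lengths_two_generated[OF nm cop] \<open>m = n + d\<close> by simp
  ultimately show ?thesis
    using that[of "glue n m UNIV UNIV" "n * m"] by simp
qed

section \<open>Realizing finitely many distances\<close>

theorem corollary3p4:
  fixes D :: "nat set"
  assumes "finite D" and "D \<noteq> {}" and "0 \<notin> D"
  shows "\<exists>H. numerical_monoid H \<and> D \<subseteq> monoid_distances H"
  using assms(1,3)
proof (induction D)
  case empty
  show ?case using numerical_monoid_UNIV by blast
next
  case (insert d D)
  then obtain A where A: "numerical_monoid A" "D \<subseteq> monoid_distances A" by auto
  then have "\<forall>e\<in>D. \<exists>x. x \<in> A \<and> e \<in> distances (lengths A x)"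
    unfolding monoid_distances_def by blast
  then obtain f where f: "\<And>e. e \<in> D \<Longrightarrow> f e \<in> A \<and> e \<in> distances (lengths A (f e))"
    by metis
  have "finite (f ` D)"
    using insert.hyps(1) by simp
  then obtain X where X: "\<forall>x\<in>f ` D. x \<le> X"
    using finite_nat_set_iff_bounded_le by blast
  obtain B y where B: "numerical_monoid B" "y \<in> B" "d \<in> distances (lengths B y)"
    using numerical_monoid_with_distance[of d] insert.prems by auto
  \<comment> \<open>Consecutive numbers are coprime, and both exceed all the elements \<open>f e\<close> of \<open>A\<close>
    and the element \<open>y\<close> of \<open>B\<close>.\<close>
  define p q where "p = X + y + 1" and "q = p + 1"
  have pq: "coprime p q" "coprime q p" "p > 0" "q > 0" "X < q" "y < p"
    by (auto simp: p_def q_def)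
  have "e \<in> monoid_distances (glue p q A B)" if "e \<in> D" for e
  proof -
    have "f e < q"
      using X that pq(5) by fastforce
    then show ?thesis
      using distances_subset_glue[OF A(1) B(1) pq(1,3)] f[OF that] by blast
  qed
  moreover have "d \<in> monoid_distances (glue p q A B)"
    using distances_subset_glue[OF B(1) A(1) pq(2,4) B(2) pq(6)] B(3)
    unfolding glue_commute[of q p] by blast
  moreover have "numerical_monoid (glue p q A B)"
    using A B pq by (intro numerical_monoid_glue) auto
  ultimately show ?case by blast
qed

end
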